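(* Let $A$ be a finite set, let $\mu$ be a shift-ergodic Borel probability measure on $A^{\mathbb{Z}}$, and let $F\colon A^{\mathbb{Z}}\to A^{\mathbb{Z}}$ be a cellular automaton having at least one $\mu$-equicontinuous point. Let $\mu_c=\lim_{n\to\infty}\frac{1}{n}\sum_{i=0}^{n-1}\mu\circ F^{-i}$ (vague limit, which exists under these hypotheses). Then the set of $F$-periodic points is dense in the topological support $S(\mu_c)$ of $\mu_c$, i.e. $S(\mu_c)\subseteq\overline{\{x\in A^{\mathbb{Z}} : F^p(x)=x \text{ for some integer } p\ge 1\}}$.
   Context: $A^{\mathbb{Z}}$ is the set of bi-infinite sequences $x=(x_i)_{i\in\mathbb{Z}}$ with $x_i\in A$, with the product topology of the discrete topologies on $A$. The shift $\sigma\colon A^{\mathbb{Z}}\to A^{\mathbb{Z}}$ is $\sigma(x)=(x_{i+1})_{i\in\mathbb{Z}}$. A cellular automaton is a continuous map $F\colon A^{\mathbb{Z}}\to A^{\mathbb{Z}}$ commuting with $\sigma$. Here $\mathbb{N}=\{0,1,2,\dots\}$. For integers $i\le j$, $x(i,j)$ denotes the word $x_i\ldots x_j$. For an integer $n\ge 0$ and $x\in A^{\mathbb{Z}}$, let $C_n(x)=\{y\in A^{\mathbb{Z}} : y_j=x_j \text{ for all } -n\le j\le n\}$ and $B_n(x)=\{y\in A^{\mathbb{Z}} : F^i(y)(-n,n)=F^i(x)(-n,n)\text{ for all } i\in\mathbb{N}\}$. A point $x$ is $\mu$-equicontinuous if for all $m\in\mathbb{N}$, $\lim_{n\to\infty}\frac{\mu(C_n(x)\cap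 B_m(x))}{\mu(C_n(x))}=1$ (in particular $\mu(C_n(x))>0$ for all $n$, so that the quotients make sense). $\mu$ is shift ergodic if it is $\sigma$-invariant and ergodic for $\sigma$; it is not assumed $F$-invariant. $\mu\circ F^{-i}$ is the image measure $E\mapsto\mu((F^{i})^{-1}(E))$. Vague convergence $\mu_n\to\mu_c$ means $\int f\,d\mu_n\to\int f\,d\mu_c$ for every continuous $f\colon A^{\mathbb{Z}}\to\mathbb{R}$. The topological support of a Borel probability measure $\nu$ is $S(\nu)=\overline{\{x\in A^{\mathbb{Z}} : \nu(C_n(x))>0 \text{ for all } n\in\mathbb{N}\}}$. A point $x$ is $F$-periodic if $F^p(x)=x$ for some integer $p\ge 1$. *)

theory Defs
  imports "HOL-Probability.Probability"
begin

text \<open>The alphabet is a finite type \<open>'a\<close> with its discrete topology; \<open>int \<Rightarrow> 'a\<close> then carries the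
  product topology and the corresponding Borel sets.\<close>

definition shift :: "(int \<Rightarrow> 'a) \<Rightarrow> int \<Rightarrow> 'a" where
  "shift x = (\<lambda>i. x (i + 1))"

definition cellular_automaton ::
    "((int \<Rightarrow> 'a::{finite, discrete_topology}) \<Rightarrow> (int \<Rightarrow> 'a)) \<Rightarrow> bool" where
  "cellular_automaton F \<longleftrightarrow> continuous_on UNIV F \<and> F \<circ> shift = shift \<circ> F"

definition borel_prob :: "'b::topological_space measure \<Rightarrow> bool" where
  "borel_prob \<mu> \<longleftrightarrow> prob_space \<mu> \<and> sets \<mu> = sets borel"

definition shift_ergodic :: "(int \<Rightarrow> 'a::{finite, discrete_topology}) measure \<Rightarrow> bool" where
  "shift_ergodic \<mu> \<longleftrightarrow> distr \<mu> borel shift = \<mu> \<and>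
     (\<forall>E\<in>sets borel. shift -` E = E \<longrightarrow> measure \<mu> E = 0 \<or> measure \<mu> E = 1)"

definition cyl :: "nat \<Rightarrow> (int \<Rightarrow> 'a) \<Rightarrow> (int \<Rightarrow> 'a) set" where
  "cyl n x = {y. \<forall>j. - int n \<le> j \<and> j \<le> int n \<longrightarrow> y j = x j}"

definition orbit_cyl ::
    "((int \<Rightarrow> 'a) \<Rightarrow> (int \<Rightarrow> 'a)) \<Rightarrow> nat \<Rightarrow> (int \<Rightarrow> 'a) \<Rightarrow> (int \<Rightarrow> 'a) set" where
  "orbit_cyl F n x =
     {y. \<forall>i. \<forall>j. - int n \<le> j \<and> j \<le> int n \<longrightarrow> (F ^^ i) y j = (F ^^ i) x j}"

definition mu_equicontinuous_point ::
    "(int \<Rightarrow> 'a::{finite, discrete_topology}) measure \<Rightarrow>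
     ((int \<Rightarrow> 'a) \<Rightarrow> (int \<Rightarrow> 'a)) \<Rightarrow> (int \<Rightarrow> 'a) \<Rightarrow> bool" where
  "mu_equicontinuous_point \<mu> F x \<longleftrightarrow> (\<forall>n. measure \<mu> (cyl n x) > 0) \<and>
     (\<forall>m. (\<lambda>n. measure \<mu> (cyl n x \<inter> orbit_cyl F m x) / measure \<mu> (cyl n x)) \<longlonglongrightarrow> 1)"

text \<open>The Borel measure \<open>(1/n) (\<mu> \<circ> F\<^sup>0 + \<dots> + \<mu> \<circ> F\<^bsup>-(n-1)\<^esup>)\<close>. For \<open>n = 0\<close> it is the zero measure,
  which does not affect limits.\<close>

definition cesaro_measure ::
    "'b::topological_space measure \<Rightarrow> ('b \<Rightarrow> 'b) \<Rightarrow> nat \<Rightarrow> 'b measure" where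
  "cesaro_measure \<mu> F n = measure_of UNIV (sets borel)
     (\<lambda>E. (\<Sum>i<n. emeasure (distr \<mu> borel (F ^^ i)) E) / of_nat n)"

lemma sets_cesaro_measure [simp]: "sets (cesaro_measure \<mu> F n) = sets borel"
  unfolding cesaro_measure_def
  by (metis sets.sets_measure_of_eq space_borel)

lemma emeasure_cesaro_measure:
  assumes "E \<in> sets borel"
  shows "emeasure (cesaro_measure \<mu> F n) E =
    (\<Sum>i<n. emeasure (distr \<mu> borel (F ^^ i)) E) / of_nat n"
proof (rule emeasure_measure_of[OF cesaro_measure_def])
  show "positive (sets (cesaro_measure \<mu> F n))
      (\<lambda>E. (\<Sum>i<n. emeasure (distr \<mu> borel (F ^^ i)) E) / of_nat n)"
    by (simp add: positive_def)
  show "countably_additive (sets (cesaro_measure \<mu> F n))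
      (\<lambda>E. (\<Sum>i<n. emeasure (distr \<mu> borel (F ^^ i)) E) / of_nat n)"
  proof (rule countably_additiveI)
    fix A :: "nat \<Rightarrow> 'a set"
    assume A: "range A \<subseteq> sets (cesaro_measure \<mu> F n)" "disjoint_family A"
    have "(\<Sum>k. (\<Sum>i<n. emeasure (distr \<mu> borel (F ^^ i)) (A k)) / of_nat n) =
        (\<Sum>i<n. \<Sum>k. emeasure (distr \<mu> borel (F ^^ i)) (A k)) / of_nat n"
      by (simp add: divide_ennreal_def suminf_sum)
    also have "\<dots> = (\<Sum>i<n. emeasure (distr \<mu> borel (F ^^ i)) (\<Union>k. A k)) / of_nat n"
      using A by (simp add: suminf_emeasure)
    finally show "(\<Sum>k. (\<Sum>i<n. emeasure (distr \<mu> borel (F ^^ i)) (A k)) / of_nat n) =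
        (\<Sum>i<n. emeasure (distr \<mu> borel (F ^^ i)) (\<Union>k. A k)) / of_nat n" .
  qed
qed (use assms in auto)

definition vague_limit ::
    "(nat \<Rightarrow> 'b::topological_space measure) \<Rightarrow> 'b measure \<Rightarrow> bool" where
  "vague_limit M \<nu> \<longleftrightarrow> borel_prob \<nu> \<and>
     (\<forall>f::'b \<Rightarrow> real. continuous_on UNIV f \<longrightarrow>
        (\<lambda>n. integral\<^sup>L (M n) f) \<longlonglongrightarrow> integral\<^sup>L \<nu> f)"

definition topological_support ::
    "(int \<Rightarrow> 'a::{finite, discrete_topology}) measure \<Rightarrow> (int \<Rightarrow> 'a) set" where
  "topological_support \<nu> = closure {x. \<forall>n. measure \<nu> (cyl n x) > 0}"

definition periodic_points :: "('b \<Rightarrow> 'b) \<Rightarrow> 'b set" where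
  "periodic_points F = {x. \<exists>p\<ge>1. (F ^^ p) x = x}"

end

theory Submission
  imports Defs
begin

text \<open>Let \<open>r\<close> be a radius of \<open>F\<close> and \<open>B = B\<^sub>r(x)\<close> for a \<open>\<mu>\<close>-equicontinuous point \<open>x\<close>; then \<open>\<mu>(B) > 0\<close>.
  By ergodicity almost every \<open>y\<close> enters \<open>B\<close> under shifts arbitrarily far to the left and to the right.
  Two such places have the same column of states for all times, so information cannot cross them: the
  spatially periodic configuration \<open>z\<close> repeating the block of \<open>y\<close> between them has the same
  \<open>F\<close>-orbit as \<open>y\<close> on that block. As \<open>z\<close> is eventually \<open>F\<close>-periodic, visits of \<open>y\<close> to a cylinder have
  a limit frequency, which gives \<open>\<mu>\<^sub>c\<close> by dominated convergence and Caratheodory extension; and if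
  \<open>\<mu>\<^sub>c\<close> charges a cylinder, then some such \<open>y\<close> visits it at arbitrarily late times, at which the
  orbit of \<open>z\<close> provides an \<open>F\<close>-periodic point in it.\<close>

section \<open>Cylinders and the product topology\<close>

lemma self_in_cyl [simp]: "x \<in> cyl n x"
  by (simp add: cyl_def)

lemma cyl_eqI: "y \<in> cyl n x \<Longrightarrow> cyl n y = cyl n x"
  by (auto simp: cyl_def)

lemma cyl_antimono: "m \<le> n \<Longrightarrow> cyl n x \<subseteq> cyl m x"
  by (force simp: cyl_def)

lemma open_cyl: "open (cyl n (x :: int \<Rightarrow> 'a::discrete_topology))"
proof -
  have "open {y. \<forall>j\<in>{- int n..int n}. y (id j) \<in> {x j}}"
    by (rule product_topology_basis') (auto simp: discrete_topology_class.open_discrete)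
  moreover have "{y. \<forall>j\<in>{- int n..int n}. y (id j) \<in> {x j}} = cyl n x"
    by (auto simp: cyl_def)
  ultimately show ?thesis by simp
qed

text \<open>A basic open set of the product restricts only finitely many coordinates, so a symmetric
  window containing all of them gives a cylinder inside it. Openness thus becomes a condition on
  finite words.\<close>

lemma open_iff_cyl:
  fixes U :: "(int \<Rightarrow> 'a::discrete_topology) set"
  shows "open U \<longleftrightarrow> (\<forall>x\<in>U. \<exists>n. cyl n x \<subseteq> U)"
proof (intro iffI ballI)
  fix x assume "open U" "x \<in> U"
  then have "openin (product_topology (\<lambda>i. euclidean) UNIV) U"
    by (simp add: open_fun_def)
  from product_topology_open_contains_basis[OF this \<open>x \<in> U\<close>] obtain X
    where X: "x \<in> Pi\<^sub>E UNIV X" "finite {i. X i \<noteq> UNIV}" "Pi\<^sub>E UNIV X \<subseteq> U"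
    by auto
  \<comment> \<open>The inserted \<open>0\<close> keeps the maximum defined when no coordinate is
    restricted.\<close>
  define n where "n = Max (insert 0 ((\<lambda>i. nat \<bar>i\<bar>) ` {i. X i \<noteq> UNIV}))"
  have n: "nat \<bar>i\<bar> \<le> n" if "X i \<noteq> UNIV" for i
    unfolding n_def using X(2) that by (intro Max_ge) auto
  have "y \<in> Pi\<^sub>E UNIV X" if y: "y \<in> cyl n x" for y
  proof -
    have "y i \<in> X i" for i
    proof (cases "X i = UNIV")
      case False
      have "- int n \<le> i \<and> i \<le> int n" using n[OF False] by linarith
      then have "y i = x i" using y by (simp add: cyl_def)
      then show ?thesis using X(1) by (simp add: PiE_iff)
    qed simp
    then show ?thesis by (simp add: PiE_iff)
  qed
  then show "\<exists>n. cyl n x \<subseteq> U" using X(3) by blast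
next
  assume *: "\<forall>x\<in>U. \<exists>n. cyl n x \<subseteq> U"
  show "open U"
  proof (subst open_subopen, intro ballI)
    fix x assume "x \<in> U"
    with * obtain n where "cyl n x \<subseteq> U" by blast
    then show "\<exists>T. open T \<and> x \<in> T \<and> T \<subseteq> U" using open_cyl self_in_cyl by metis
  qed
qed

lemma closed_cyl: "closed (cyl n (x :: int \<Rightarrow> 'a::discrete_topology))"
  unfolding closed_def open_iff_cyl
proof
  fix y assume "y \<in> - cyl n x"
  then have "cyl n y \<subseteq> - cyl n x" by (auto simp: cyl_def)
  then show "\<exists>m. cyl m y \<subseteq> - cyl n x" by blast
qed

section \<open>Compactness and uniform windows\<close>

lemma compact_UNIV_fun: "compact (UNIV :: ('i \<Rightarrow> 'a::{finite, topological_space}) set)"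
proof -
  have "compact_space (product_topology (\<lambda>i. euclidean :: 'a topology) (UNIV :: 'i set))"
    by (intro iffD2[OF compact_space_product_topology] disjI2 ballI)
       (auto simp: compact_space_def intro: finite_imp_compact)
  then show ?thesis
    by (simp add: euclidean_product_topology compact_space_def)
qed

text \<open>A Lebesgue number argument: finitely many of the given cylinders cover the compact
  space, and the largest of their radii serves every point, since two points in a common cylinder
  define the same cylinder.\<close>

lemma uniform_window:
  fixes Q :: "(int \<Rightarrow> 'a::{finite, discrete_topology}) \<Rightarrow> (int \<Rightarrow> 'a) \<Rightarrow> bool"
  assumes "\<And>x. \<exists>n. \<forall>y\<in>cyl n x. \<forall>z\<in>cyl n x. Q y z"
  shows "\<exists>n. \<forall>y. \<forall>z\<in>cyl n y. Q y z"
proof -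
  from assms obtain n where n: "\<And>x y z. y \<in> cyl (n x) x \<Longrightarrow> z \<in> cyl (n x) x \<Longrightarrow> Q y z"
    by metis
  have "UNIV \<subseteq> (\<Union>x. cyl (n x) x)" using self_in_cyl by blast
  from compactE_image[OF compact_UNIV_fun open_cyl this] obtain T
    where T: "finite T" "UNIV \<subseteq> (\<Union>x\<in>T. cyl (n x) x)" by metis
  define N where "N = Max (n ` T)"
  have "Q y z" if "z \<in> cyl N y" for y z
  proof -
    from T(2) obtain x where x: "x \<in> T" "y \<in> cyl (n x) x" by blast
    have "n x \<le> N" unfolding N_def using T(1) x(1) by simp
    then have "z \<in> cyl (n x) y" using that cyl_antimono by blast
    then show ?thesis using n[OF x(2)] cyl_eqI[OF x(2)] by blast
  qed
  then show ?thesis by blast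
qed

lemma clopen_window:
  fixes C :: "(int \<Rightarrow> 'a::{finite, discrete_topology}) set"
  assumes "open C" "closed C"
  shows "\<exists>n. \<forall>y. \<forall>z\<in>cyl n y. z \<in> C \<longleftrightarrow> y \<in> C"
proof -
  have "\<exists>n. \<forall>y\<in>cyl n x. \<forall>z\<in>cyl n x. z \<in> C \<longleftrightarrow> y \<in> C" for x
  proof (cases "x \<in> C")
    case True
    then show ?thesis using assms(1) unfolding open_iff_cyl by blast
  next
    case False
    then show ?thesis using assms(2) unfolding closed_def open_iff_cyl by blast
  qed
  from uniform_window[OF this] show ?thesis .
qed

lemma continuous_window:
  fixes f :: "(int \<Rightarrow> 'a::{finite, discrete_topology}) \<Rightarrow> real"
  assumes "continuous_on UNIV f" "e > 0"
  shows "\<exists>n. \<forall>y. \<forall>z\<in>cyl n y. \<bar>f y - f z\<bar> < e"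
proof -
  have "\<exists>n. \<forall>y\<in>cyl n x. \<forall>z\<in>cyl n x. \<bar>f y - f z\<bar> < e" for x
  proof -
    \<comment> \<open>Half of \<open>e\<close>, since \<open>y\<close> and \<open>z\<close> are each
      compared with the centre \<open>x\<close>.\<close>
    have "open (f -` ball (f x) (e / 2))"
      using assms(1) by (intro open_vimage) auto
    moreover have "x \<in> f -` ball (f x) (e / 2)" using assms(2) by simp
    ultimately obtain n where n: "cyl n x \<subseteq> f -` ball (f x) (e / 2)"
      unfolding open_iff_cyl by blast
    have close: "\<bar>f x - f y\<bar> < e / 2" if "y \<in> cyl n x" for y
      using subsetD[OF n that] by (simp add: dist_real_def)
    have "\<bar>f y - f z\<bar> < e" if "y \<in> cyl n x" "z \<in> cyl n x" for y z
      using close[OF that(1)] close[OF that(2)] by linarith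
    then show ?thesis by blast
  qed
  from uniform_window[OF this] show ?thesis .
qed

text \<open>A normal form for words on the window: entries outside it are \<open>undefined\<close>.
  The cylinders of radius \<open>n\<close> become a partition with a finite canonical index
  set.\<close>

definition cyl_reps :: "nat \<Rightarrow> (int \<Rightarrow> 'a::finite) set" where
  "cyl_reps n = {t. \<forall>j. int n < \<bar>j\<bar> \<longrightarrow> t j = undefined}"

lemma finite_cyl_reps: "finite (cyl_reps n :: (int \<Rightarrow> 'a::finite) set)"
proof -
  have "inj_on (\<lambda>t. restrict t {- int n..int n}) (cyl_reps n :: (int \<Rightarrow> 'a) set)"
  proof (rule inj_onI, rule ext)
    fix s t :: "int \<Rightarrow> 'a" and j
    assume *: "s \<in> cyl_reps n" "t \<in> cyl_reps n"
      "restrict s {- int n..int n} = restrict t {- int n..int n}"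
    show "s j = t j"
    proof (cases "int n < \<bar>j\<bar>")
      case True
      then show ?thesis using * by (simp add: cyl_reps_def)
    next
      case False
      then show ?thesis using fun_cong[OF *(3), of j] by (auto simp: restrict_def split: if_splits)
    qed
  qed
  moreover have "(\<lambda>t. restrict t {- int n..int n}) ` (cyl_reps n :: (int \<Rightarrow> 'a) set) \<subseteq> Pi\<^sub>E {- int n..int n} (\<lambda>_. UNIV)"
    by auto
  ultimately show ?thesis by (rule inj_on_finite) (auto intro: finite_PiE)
qed

lemma cyl_rep_unique: "\<exists>!t. t \<in> cyl_reps n \<and> y \<in> cyl n t"
proof (rule ex1I[of _ "\<lambda>j. if int n < \<bar>j\<bar> then undefined else y j"])
  fix t assume "t \<in> cyl_reps n \<and> y \<in> cyl n t"
  then show "t = (\<lambda>j. if int n < \<bar>j\<bar> then undefined else y j)"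
    by (auto simp: cyl_reps_def cyl_def fun_eq_iff not_less abs_le_iff)
qed (auto simp: cyl_reps_def cyl_def)

text \<open>Every open set is a countable union, over the window size, of finite unions of
  cylinders, and cylinders are clopen. A measure extended from clopen sets therefore lives on all
  Borel sets.\<close>

lemma sigma_sets_clopen:
  "sigma_sets UNIV {C :: (int \<Rightarrow> 'a::{finite, discrete_topology}) set. open C \<and> closed C} = sets borel"
proof
  have "{C :: (int \<Rightarrow> 'a) set. open C \<and> closed C} \<subseteq> sets borel"
    by (simp add: borel_open subset_iff)
  then show "sigma_sets UNIV {C :: (int \<Rightarrow> 'a) set. open C \<and> closed C} \<subseteq> sets borel"
    using sets.sigma_sets_subset[of "{C :: (int \<Rightarrow> 'a) set. open C \<and> closed C}" borel]
    unfolding space_borel by blast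
  have "U \<in> sigma_sets UNIV {C :: (int \<Rightarrow> 'a) set. open C \<and> closed C}" if "open U" for U
  proof -
    have eq: "U = (\<Union>n. \<Union>t\<in>{t\<in>cyl_reps n. cyl n t \<subseteq> U}. cyl n t)"
    proof (intro equalityI subsetI)
      fix x assume "x \<in> U"
      then obtain n where n: "cyl n x \<subseteq> U" using \<open>open U\<close> unfolding open_iff_cyl by blast
      obtain t where t: "t \<in> cyl_reps n" "x \<in> cyl n t" using cyl_rep_unique[of n x] by blast
      then show "x \<in> (\<Union>n. \<Union>t\<in>{t\<in>cyl_reps n. cyl n t \<subseteq> U}. cyl n t)"
        using n cyl_eqI[OF t(2)] by blast
    qed auto
    interpret sigma_algebra UNIV "sigma_sets UNIV {C :: (int \<Rightarrow> 'a) set. open C \<and> closed C}"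
      by (rule sigma_algebra_sigma_sets) simp
    have "(\<Union>t\<in>{t\<in>cyl_reps n. cyl n t \<subseteq> U}. cyl n t)
        \<in> sigma_sets UNIV {C :: (int \<Rightarrow> 'a) set. open C \<and> closed C}" for n
    proof (rule finite_UN)
      show "finite {t :: int \<Rightarrow> 'a. t \<in> cyl_reps n \<and> cyl n t \<subseteq> U}"
        by (rule finite_subset[OF _ finite_cyl_reps[of n]]) simp
    qed (rule sigma_sets.Basic, simp add: open_cyl closed_cyl)
    then have "(\<Union>n. \<Union>t\<in>{t\<in>cyl_reps n. cyl n t \<subseteq> U}. cyl n t)
        \<in> sigma_sets UNIV {C :: (int \<Rightarrow> 'a) set. open C \<and> closed C}"
      by (intro countable_nat_UN image_subsetI)
    then show ?thesis unfolding eq[symmetric] .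
  qed
  then show "sets borel \<subseteq> sigma_sets UNIV {C :: (int \<Rightarrow> 'a) set. open C \<and> closed C}"
    unfolding sets_borel by (intro sigma_sets_mono) blast
qed

section \<open>Cellular automata and periodic configurations\<close>

text \<open>The integer powers of \<open>shift\<close>, negative ones included, so that moves to the
  left and to the right share one notation.\<close>

definition translate :: "int \<Rightarrow> (int \<Rightarrow> 'a) \<Rightarrow> int \<Rightarrow> 'a" where
  "translate k x = (\<lambda>i. x (i + k))"

lemma translate_0 [simp]: "translate 0 = id"
  by (simp add: translate_def fun_eq_iff)

lemma translate_translate [simp]: "translate k (translate l x) = translate (k + l) x"
  by (simp add: translate_def fun_eq_iff algebra_simps)

lemma translate_apply: "translate k x i = x (i + k)"
  by (simp add: translate_def)

lemma shift_eq_translate: "shift = translate 1"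
  by (simp add: shift_def translate_def fun_eq_iff)

lemma continuous_translate: "continuous_on UNIV (translate k :: (int \<Rightarrow> 'a::topological_space) \<Rightarrow> _)"
  unfolding translate_def by (intro continuous_intros) auto

lemma measurable_translate [measurable]:
  "translate k \<in> borel_measurable (borel :: (int \<Rightarrow> 'a::topological_space) measure)"
  by (intro borel_measurable_continuous_onI continuous_translate)

text \<open>A configuration of period \<open>p\<close> is determined by its symbols on
  \<open>{0..<p}\<close>.\<close>

lemma finite_spatially_periodic:
  assumes "p > 0"
  shows "finite {z :: int \<Rightarrow> 'a::finite. translate p z = z}"
proof -
  have mod: "z i = z (i mod p)" if "translate p z = z" for z :: "int \<Rightarrow> 'a" and i
  proof -
    have 1: "z (i + p) = z i" for i
      using fun_cong[OF that, of i] by (simp add: translate_def)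
    have 2: "z (i + int n * p) = z i" for n i
    proof (induction n)
      case (Suc n)
      then show ?case using 1[of "i + int n * p"] by (simp add: algebra_simps)
    qed simp
    have 3: "z (i + k * p) = z i" for k i
    proof (cases "k \<ge> 0")
      case True
      then show ?thesis using 2[of i "nat k"] by simp
    next
      case False
      then show ?thesis using 2[of "i + k * p" "nat (- k)"] by simp
    qed
    show ?thesis using 3[of "i mod p" "i div p"] by simp
  qed
  have "inj_on (\<lambda>z. restrict z {0..<p}) {z :: int \<Rightarrow> 'a. translate p z = z}"
  proof (rule inj_onI, rule ext)
    fix s t :: "int \<Rightarrow> 'a" and j
    assume *: "s \<in> {z. translate p z = z}" "t \<in> {z. translate p z = z}"
      "restrict s {0..<p} = restrict t {0..<p}"
    have "s (j mod p) = t (j mod p)"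
      using fun_cong[OF *(3), of "j mod p"] assms by simp
    then show "s j = t j"
      using mod[OF CollectD[OF *(1)], of j] mod[OF CollectD[OF *(2)], of j] by metis
  qed
  moreover have "(\<lambda>z. restrict z {0..<p}) ` {z :: int \<Rightarrow> 'a. translate p z = z} \<subseteq> Pi\<^sub>E {0..<p} (\<lambda>_. UNIV)"
    by auto
  ultimately show ?thesis by (rule inj_on_finite) (auto intro: finite_PiE)
qed

text \<open>Agreement spreads from one block to margins of width \<open>m\<close> on both sides: on
  a margin, \<open>u\<close> repeats the opposite end of the block by periodicity, and
  \<open>v\<close> does so because it looks the same around \<open>k\<close> and
  \<open>k + p\<close>. As \<open>m < p\<close>, one translation by \<open>p\<close> leads from
  either margin into the block.\<close>

lemma agree_extend:
  assumes "translate p u = u" "int m < p"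
    and v: "\<And>j. \<bar>j\<bar> \<le> int m \<Longrightarrow> v (k + j) = v (k + p + j)"
    and eq: "\<And>j. k \<le> j \<Longrightarrow> j < k + p \<Longrightarrow> u j = v j"
    and j: "k - int m \<le> j" "j \<le> k + p + int m"
  shows "u j = v j"
proof -
  have per: "u (i + p) = u i" for i
    using fun_cong[OF assms(1), of i] by (simp add: translate_def)
  consider "j < k" | "k \<le> j" "j < k + p" | "k + p \<le> j" by linarith
  then show ?thesis
  proof cases
    case 1
    have "u j = u (j + p)" by (simp only: per)
    also have "\<dots> = v (j + p)" using 1 j assms(2) by (intro eq) auto
    also have "j + p = k + p + (j - k)" by simp
    also have "v \<dots> = v (k + (j - k))" using 1 j by (intro v[symmetric]) auto
    finally show ?thesis by simp
  next
    case 3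
    have "u j = u (j - p)" using per[of "j - p"] by (simp only: diff_add_cancel)
    also have "\<dots> = v (j - p)" using 3 j assms(2) by (intro eq) auto
    also have "j - p = k + (j - p - k)" by simp
    also have "v \<dots> = v (k + p + (j - p - k))" using 3 j by (intro v) auto
    finally show ?thesis by simp
  qed (rule eq)
qed

section \<open>Locality, eventual periodicity and shadowing for a cellular automaton\<close>

context
  fixes F :: "(int \<Rightarrow> 'a::{finite, discrete_topology}) \<Rightarrow> (int \<Rightarrow> 'a)"
  assumes ca: "cellular_automaton F"
begin

lemma ca_translate: "F (translate k x) = translate k (F x)"
proof -
  have 1: "F (translate 1 x) = translate 1 (F x)" for x
    using ca by (simp add: cellular_automaton_def shift_eq_translate o_def fun_eq_iff)
  have 2: "F (translate (int n) x) = translate (int n) (F x)" for n x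
  proof (induction n arbitrary: x)
    case (Suc n)
    have "F (translate (int (Suc n)) x) = F (translate 1 (translate (int n) x))"
      by (simp add: add.commute)
    also have "\<dots> = translate (int (Suc n)) (F x)"
      by (subst 1, subst Suc) (simp add: add.commute)
    finally show ?case .
  qed simp
  show ?thesis
  proof (cases "k \<ge> 0")
    case True
    then show ?thesis using 2[of "nat k"] by simp
  next
    case False
    \<comment> \<open>A negative translation inverts a positive one: the case already proved is
      applied to \<open>translate k x\<close>.\<close>
    then have "translate k (F (translate (- k) (translate k x))) = F (translate k x)"
      using 2[of "nat (- k)" "translate k x"] by simp
    then show ?thesis by simp
  qed
qed

lemma ca_funpow_translate: "(F ^^ i) (translate k x) = translate k ((F ^^ i) x)"
  by (induction i) (simp_all add: ca_translate)

lemma continuous_ca_funpow: "continuous_on UNIV (F ^^ i)"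
proof (induction i)
  case (Suc i)
  have "continuous_on UNIV F" using ca by (simp add: cellular_automaton_def)
  with Suc show ?case
    unfolding funpow.simps(2) by (intro continuous_on_compose) (auto intro: continuous_on_subset)
qed (simp add: id_def)

lemma measurable_ca_funpow [measurable]: "F ^^ i \<in> borel_measurable borel"
  by (rule borel_measurable_continuous_onI[OF continuous_ca_funpow])

text \<open>The local rule of Curtis, Hedlund and Lyndon: continuity and compactness give a window
  that determines cell \<open>0\<close> of the image, and commutation with translations carries it
  to every cell.\<close>

lemma ca_local:
  "\<exists>r. \<forall>x y j. (\<forall>i. \<bar>i - j\<bar> \<le> int r \<longrightarrow> x i = y i) \<longrightarrow> F x j = F y j"
proof -
  have "\<exists>n. \<forall>y\<in>cyl n x. \<forall>z\<in>cyl n x. F y 0 = F z 0" for x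
  proof -
    have "open (F -` cyl 0 (F x))"
      using continuous_ca_funpow[of 1] by (intro open_vimage open_cyl) simp_all
    moreover have "x \<in> F -` cyl 0 (F x)" by simp
    ultimately obtain n where n: "cyl n x \<subseteq> F -` cyl 0 (F x)" unfolding open_iff_cyl by blast
    have "F y 0 = F z 0" if "y \<in> cyl n x" "z \<in> cyl n x" for y z
      using subsetD[OF n that(1)] subsetD[OF n that(2)] by (simp add: cyl_def)
    then show ?thesis by blast
  qed
  from uniform_window[OF this] obtain r where r: "\<And>y z. z \<in> cyl r y \<Longrightarrow> F y 0 = F z 0"
    by metis
  have "F x j = F y j" if *: "\<forall>i. \<bar>i - j\<bar> \<le> int r \<longrightarrow> x i = y i" for x y j
  proof -
    have "translate j y \<in> cyl r (translate j x)"
      unfolding cyl_def translate_def using *[rule_format] by (simp add: abs_le_iff)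
    from r[OF this] show ?thesis by (simp add: ca_translate translate_apply)
  qed
  then show ?thesis by (intro exI[of _ r] allI impI)
qed

text \<open>Pigeonhole: \<open>F\<close> commutes with translations, so the orbit stays among the
  finitely many configurations of spatial period \<open>p\<close> and must repeat a value; from then
  on it cycles.\<close>

lemma spatially_periodic_eventually_periodic:
  assumes "p > 0" "translate p z = z"
  shows "\<exists>q d. d > 0 \<and> (\<forall>i\<ge>q. (F ^^ (i + d)) z = (F ^^ i) z)"
proof -
  have "range (\<lambda>i. (F ^^ i) z) \<subseteq> {z. translate p z = z}"
    by (simp add: image_subset_iff ca_funpow_translate[symmetric] assms(2))
  then have "\<not> inj (\<lambda>i. (F ^^ i) z)"
    using finite_subset[OF _ finite_spatially_periodic[OF assms(1)]]
      range_inj_infinite[of "\<lambda>i. (F ^^ i) z"] by auto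
  then obtain a b where "a < b" "(F ^^ a) z = (F ^^ b) z"
    using linorder_injI[of "\<lambda>i. (F ^^ i) z"] by blast
  then obtain q d where qd: "d > 0" "(F ^^ (q + d)) z = (F ^^ q) z"
    using less_imp_add_positive[of a b] that[of _ a] by force
  have "(F ^^ (i + d)) z = (F ^^ i) z" if "i \<ge> q" for i
  proof -
    obtain e where e: "i = e + q" using le_Suc_ex[OF \<open>i \<ge> q\<close>] add.commute by metis
    have "(F ^^ (i + d)) z = (F ^^ e) ((F ^^ (q + d)) z)"
      by (simp add: e add.assoc funpow_add)
    then show ?thesis unfolding qd(2) by (simp add: e funpow_add)
  qed
  then show ?thesis using qd by blast
qed

text \<open>The columns of radius \<open>r\<close> around \<open>k\<close> and \<open>k + p\<close>
  coincide at all times, so the line may be closed to a circle of length \<open>p\<close> without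
  any effect on the block. In the induction on time, cells of the block see at most \<open>r\<close>
  cells beyond it, where agreement is already known; \<open>agree_extend\<close> then restores
  agreement on these margins for the next time.\<close>

lemma periodic_shadow:
  assumes r: "\<And>x y j. (\<forall>i. \<bar>i - j\<bar> \<le> int r \<longrightarrow> x i = y i) \<Longrightarrow> F x j = F y j"
    and B: "translate k y \<in> orbit_cyl F r x" "translate (k + p) y \<in> orbit_cyl F r x"
    and p: "int r < p"
  shows "\<exists>z. translate p z = z \<and>
    (\<forall>i j. k - int r \<le> j \<longrightarrow> j \<le> k + p + int r \<longrightarrow> (F ^^ i) z j = (F ^^ i) y j)"
proof -
  \<comment> \<open>The word of \<open>y\<close> on \<open>{k..<k + p}\<close>, repeated
    periodically.\<close>
  define z where "z = (\<lambda>j. y (k + (j - k) mod p))"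
  have z: "translate p z = z"
  proof
    fix j
    have "(j + p - k) mod p = (j - k) mod p"
      using mod_add_self2[of "j - k" p] by (simp add: algebra_simps)
    then show "translate p z j = z j" by (simp add: z_def translate_def)
  qed
  \<comment> \<open>Both columns equal the central column of \<open>x\<close> at every time.\<close>
  have wall: "(F ^^ i) y (k + j) = (F ^^ i) y (k + p + j)" if "\<bar>j\<bar> \<le> int r" for i j
  proof -
    have "(F ^^ i) (translate k y) j = (F ^^ i) (translate (k + p) y) j"
      using B that by (auto simp: orbit_cyl_def abs_le_iff)
    then show ?thesis by (simp add: ca_funpow_translate translate_apply add.commute)
  qed
  have zi: "translate p ((F ^^ i) z) = (F ^^ i) z" for i
    using z by (simp flip: ca_funpow_translate)
  have "(F ^^ i) z j = (F ^^ i) y j" if "k - int r \<le> j" "j \<le> k + p + int r" for i j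
    using that
  proof (induction i arbitrary: j)
    case 0
    show ?case
      unfolding funpow_0
    proof (rule agree_extend[OF z p, where v = y and k = k])
      show "z j = y j" if "k \<le> j" "j < k + p" for j using that by (simp add: z_def)
      show "y (k + j) = y (k + p + j)" if "\<bar>j\<bar> \<le> int r" for j
        using wall[OF that, of 0] unfolding funpow_0 .
    qed (use 0 in auto)
  next
    case (Suc i)
    show ?case
    proof (rule agree_extend[OF zi[of "Suc i"] p, where v = "(F ^^ Suc i) y" and k = k])
      show "(F ^^ Suc i) z j = (F ^^ Suc i) y j" if "k \<le> j" "j < k + p" for j
        using that by (simp, intro r) (auto intro!: Suc.IH)
      show "(F ^^ Suc i) y (k + j) = (F ^^ Suc i) y (k + p + j)" if "\<bar>j\<bar> \<le> int r" for j
        using wall[OF that] .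
    qed (use Suc.prems in auto)
  qed
  with z show ?thesis by blast
qed

end

section \<open>Averages and limits of measures\<close>

lemma bounded_over_n_tendsto_0:
  fixes S :: "nat \<Rightarrow> real"
  assumes "\<And>n. \<bar>S n\<bar> \<le> K"
  shows "(\<lambda>n. S n / real n) \<longlonglongrightarrow> 0"
proof (rule Lim_null_comparison)
  show "\<forall>\<^sub>F n in sequentially. norm (S n / real n) \<le> K / real n"
    using assms by (auto intro!: always_eventually divide_right_mono simp: abs_divide)
  show "(\<lambda>n. K / real n) \<longlonglongrightarrow> 0" by (rule lim_const_over_n)
qed

text \<open>Removing linear growth at the mean rate of one period leaves a deviation
  \<open>D\<close> that is itself eventually periodic, hence bounded, and disappears after division
  by \<open>n\<close>.\<close>

lemma eventually_periodic_cesaro_convergent: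
  fixes a :: "nat \<Rightarrow> real"
  assumes "d > 0" and per: "\<And>i. i \<ge> q \<Longrightarrow> a (i + d) = a i"
  shows "convergent (\<lambda>n. (\<Sum>i<n. a i) / real n)"
proof -
  define c where "c = (\<Sum>i=q..<q+d. a i) / real d"
  define D where "D n = (\<Sum>i<n. a i) - real n * c" for n
  have block: "(\<Sum>i=n..<n+d. a i) = real d * c" if "n \<ge> q" for n
    using that
  proof (induction n rule: dec_induct)
    case base
    show ?case using assms(1) by (simp add: c_def)
  next
    case (step n)
    have "(\<Sum>i=n..<n+d. a i) + a (n + d) = a n + (\<Sum>i=Suc n..<Suc n+d. a i)"
      using sum.atLeast_Suc_lessThan[of n "Suc n + d" a] by (simp add: add.commute)
    with per[of n] step show ?case by simp
  qed
  have D: "D (n + d) = D n" if "n \<ge> q" for n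
  proof -
    have "(\<Sum>i<n+d. a i) = (\<Sum>i<n. a i) + (\<Sum>i=n..<n+d. a i)"
      using sum.atLeastLessThan_concat[of 0 n "n + d" a] by (simp add: lessThan_atLeast0)
    then show ?thesis using block[OF that] by (simp add: D_def algebra_simps)
  qed
  \<comment> \<open>Beyond \<open>q + d\<close>, subtracting \<open>d\<close> keeps the index at
    least \<open>q\<close>, so the values of \<open>D\<close> on \<open>{..q+d}\<close> already
    bound all of them.\<close>
  define K where "K = Max ((\<lambda>n. \<bar>D n\<bar>) ` {..q+d})"
  have "\<bar>D n\<bar> \<le> K" for n
  proof (induction n rule: less_induct)
    case (less n)
    show ?case
    proof (cases "n \<le> q + d")
      case True
      then show ?thesis unfolding K_def by (intro Max_ge) auto
    next
      case False
      then have "D n = D (n - d)" using D[of "n - d"] by simp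
      moreover have "n - d < n" using False assms(1) by simp
      ultimately show ?thesis using less.IH[of "n - d"] by simp
    qed
  qed
  then have "(\<lambda>n. c + D n / real n) \<longlonglongrightarrow> c + 0"
    by (intro tendsto_add tendsto_const bounded_over_n_tendsto_0)
  moreover have "\<forall>\<^sub>F n in sequentially. c + D n / real n = (\<Sum>i<n. a i) / real n"
    using eventually_gt_at_top[of 0] by eventually_elim (simp add: D_def field_simps)
  ultimately have "(\<lambda>n. (\<Sum>i<n. a i) / real n) \<longlonglongrightarrow> c + 0"
    by (rule Lim_transform_eventually)
  then show ?thesis by (rule convergentI)
qed

text \<open>In Caratheodory's theorem the condition left beyond finite additivity is continuity at
  the empty set. Compactness supplies it: a decreasing sequence of clopen sets with empty
  intersection is empty from some index on.\<close>

lemma clopen_content_extension: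
  fixes L :: "(int \<Rightarrow> 'a::{finite, discrete_topology}) set \<Rightarrow> real"
  assumes nonneg: "\<And>C. 0 \<le> L C"
    and add: "\<And>C D. open C \<Longrightarrow> closed C \<Longrightarrow> open D \<Longrightarrow> closed D \<Longrightarrow> C \<inter> D = {} \<Longrightarrow>
      L (C \<union> D) = L C + L D"
    and one: "L UNIV = 1"
  shows "\<exists>\<nu>. borel_prob \<nu> \<and> (\<forall>C. open C \<longrightarrow> closed C \<longrightarrow> measure \<nu> C = L C)"
proof -
  let ?M = "{C :: (int \<Rightarrow> 'a) set. open C \<and> closed C}"
  interpret ring_of_sets UNIV ?M
    by (rule ring_of_setsI) (auto intro: open_Diff closed_Diff)
  have L_empty: "L {} = 0" using add[of "{}" "{}"] by simp
  have "\<exists>m. (\<forall>s\<in>?M. m s = ennreal (L s)) \<and> measure_space UNIV (sigma_sets UNIV ?M) m"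
  proof (rule caratheodory_empty_continuous)
    show "positive ?M (\<lambda>s. ennreal (L s))" by (simp add: positive_def L_empty)
    show "additive ?M (\<lambda>s. ennreal (L s))" by (simp add: additive_def add nonneg)
    fix A :: "nat \<Rightarrow> (int \<Rightarrow> 'a) set"
    assume A: "range A \<subseteq> ?M" "decseq A" "(\<Inter>i. A i) = {}"
    have "\<exists>i. A i = {}"
    proof (rule ccontr)
      assume ne: "\<nexists>i. A i = {}"
      have "UNIV \<inter> (\<Inter>i\<in>UNIV. A i) \<noteq> {}"
      proof (rule compact_imp_fip_image[OF compact_UNIV_fun])
        show "closed (A i)" for i using A(1) by blast
        fix I :: "nat set" assume "finite I"
        \<comment> \<open>The sets are nested, so a finite intersection contains its member of
          largest index; \<open>0\<close> covers the case of no indices.\<close>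
        have "A (Max (insert 0 I)) \<subseteq> (\<Inter>i\<in>I. A i)"
        proof (rule INT_greatest)
          fix i assume "i \<in> I"
          then show "A (Max (insert 0 I)) \<subseteq> A i" using \<open>finite I\<close> by (intro decseqD[OF A(2)]) simp
        qed
        then show "UNIV \<inter> (\<Inter>i\<in>I. A i) \<noteq> {}" using ne by blast
      qed
      with A(3) show False by simp
    qed
    then obtain i where i: "A i = {}" ..
    then have "A n = {}" if "n \<ge> i" for n
      using decseqD[OF A(2) that] by simp
    then have "\<forall>\<^sub>F n in sequentially. ennreal (L (A n)) = 0"
      by (intro eventually_sequentiallyI[of i]) (simp add: L_empty)
    then show "(\<lambda>n. ennreal (L (A n))) \<longlonglongrightarrow> 0" by (rule tendsto_eventually)
  qed simp
  then obtain m where m: "\<And>s. s \<in> ?M \<Longrightarrow> m s = ennreal (L s)"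
    and ms: "measure_space UNIV (sigma_sets UNIV ?M) m" by blast
  \<comment> \<open>The extension \<open>m\<close> is placed on the Borel sets, which are the
    generated sigma-algebra by \<open>sigma_sets_clopen\<close>.\<close>
  define \<nu> where "\<nu> = measure_of UNIV (sets borel) m"
  have sets: "sets \<nu> = sets borel"
    unfolding \<nu>_def by (metis sets.sets_measure_of_eq space_borel)
  have em: "emeasure \<nu> E = m E" if "E \<in> sets borel" for E
    by (rule emeasure_measure_of[OF \<nu>_def])
       (use ms that in \<open>auto simp: measure_space_def sets sigma_sets_clopen\<close>)
  have "emeasure \<nu> UNIV = 1" using em[of UNIV] m[of UNIV] by (simp add: one)
  moreover have "space \<nu> = UNIV" using sets_eq_imp_space_eq[OF sets] by simp
  ultimately have "borel_prob \<nu>"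
    unfolding borel_prob_def using sets by (auto intro: prob_spaceI)
  moreover have "measure \<nu> C = L C" if "open C" "closed C" for C
    using em[of C] m[of C] that by (simp add: measure_def nonneg)
  ultimately show ?thesis by blast
qed

section \<open>Vague convergence tested on cylinders\<close>

lemma measurable_cyl [measurable]: "cyl n (x :: int \<Rightarrow> 'a::discrete_topology) \<in> sets borel"
  by (simp add: open_cyl)

lemma cyl_rep_sum:
  fixes f :: "(int \<Rightarrow> 'a::finite) \<Rightarrow> real"
  assumes "t \<in> cyl_reps n" "y \<in> cyl n t"
  shows "(\<Sum>s\<in>cyl_reps n. f s * indicat_real (cyl n s) y) = f t"
proof -
  have "(\<Sum>s\<in>cyl_reps n. f s * indicat_real (cyl n s) y) = (\<Sum>s\<in>cyl_reps n. if s = t then f t else 0)"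
    using cyl_rep_unique[of n y] assms by (intro sum.cong) (auto simp: indicator_def)
  then show ?thesis using assms(1) by (simp add: finite_cyl_reps)
qed

text \<open>The step function \<open>g\<close> samples \<open>f\<close> at the representative of
  each cylinder, with pointwise error at most \<open>e\<close>. The bound \<open>1\<close> on the
  mass, which admits the zero measure, keeps the integrated error below \<open>e\<close>.\<close>

lemma cyl_average_approx:
  fixes f :: "(int \<Rightarrow> 'a::{finite, discrete_topology}) \<Rightarrow> real"
  assumes "finite_measure M" "sets M = sets borel" "measure M UNIV \<le> 1"
    and "continuous_on UNIV f" and n: "\<And>y z. z \<in> cyl n y \<Longrightarrow> \<bar>f y - f z\<bar> \<le> e" and "e \<ge> 0"
  shows "\<bar>integral\<^sup>L M f - (\<Sum>t\<in>cyl_reps n. f t * measure M (cyl n t))\<bar> \<le> e"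
proof -
  interpret finite_measure M by fact
  have space: "space M = UNIV" using sets_eq_imp_space_eq[OF assms(2)] by simp
  have cyl: "cyl n t \<in> sets M" for t :: "int \<Rightarrow> 'a" using assms(2) measurable_cyl by blast
  define g where "g y = (\<Sum>t\<in>cyl_reps n. f t * indicat_real (cyl n t) y)" for y
  have close: "\<bar>f y - g y\<bar> \<le> e" for y
  proof -
    obtain t where t: "t \<in> cyl_reps n" "y \<in> cyl n t" using cyl_rep_unique[of n y] by blast
    have "\<bar>f t - f y\<bar> \<le> e" by (rule n[OF t(2)])
    then show ?thesis by (simp add: g_def cyl_rep_sum[OF t] abs_minus_commute)
  qed
  have int_ind: "integrable M (\<lambda>y. f t * indicat_real (cyl n t) y)" for t
    using cyl by (intro integrable_mult_right integrable_real_indicator) (auto simp: less_top[symmetric])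
  then have int_g: "integrable M g" unfolding g_def by (rule Bochner_Integration.integrable_sum)
  have "compact (f ` UNIV)" using assms(4) compact_UNIV_fun by (rule compact_continuous_image)
  then obtain K where K: "\<And>y. norm (f y) \<le> K"
    using compact_imp_bounded bounded_iff by (metis rangeI)
  have "f \<in> borel_measurable M"
    using borel_measurable_continuous_onI[OF assms(4)] measurable_cong_sets[OF assms(2) refl] by blast
  then have int_f: "integrable M f" using K by (intro integrable_const_bound[where B = K]) auto
  have "integral\<^sup>L M g = (\<Sum>t\<in>cyl_reps n. f t * measure M (cyl n t))"
    unfolding g_def using int_ind cyl by (subst Bochner_Integration.integral_sum) (auto simp: space)
  then have "\<bar>integral\<^sup>L M f - (\<Sum>t\<in>cyl_reps n. f t * measure M (cyl n t))\<bar>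
      = \<bar>integral\<^sup>L M (\<lambda>y. f y - g y)\<bar>"
    using int_f int_g by simp
  also have "\<dots> \<le> integral\<^sup>L M (\<lambda>y. \<bar>f y - g y\<bar>)"
    by (rule integral_abs_bound)
  also have "\<dots> \<le> integral\<^sup>L M (\<lambda>y. e)"
    using int_f int_g close by (intro integral_mono) auto
  also have "\<dots> \<le> e" using assms(3,6) by (simp add: space mult_left_le_one_le)
  finally show ?thesis .
qed

text \<open>An argument with three thirds of \<open>e\<close>: finite sums over cylinders
  approximate the integrals uniformly in \<open>N\<close>, and these sums converge term by
  term.\<close>

lemma vague_limitI_cyl:
  fixes M :: "nat \<Rightarrow> (int \<Rightarrow> 'a::{finite, discrete_topology}) measure"
  assumes fin: "\<And>N. finite_measure (M N)" and sets: "\<And>N. sets (M N) = sets borel"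
    and le1: "\<And>N. measure (M N) UNIV \<le> 1" and \<nu>: "borel_prob \<nu>"
    and lim: "\<And>n t. (\<lambda>N. measure (M N) (cyl n t)) \<longlonglongrightarrow> measure \<nu> (cyl n t)"
  shows "vague_limit M \<nu>"
  unfolding vague_limit_def
proof (intro conjI \<nu> allI impI)
  fix f :: "(int \<Rightarrow> 'a) \<Rightarrow> real" assume f: "continuous_on UNIV f"
  show "(\<lambda>N. integral\<^sup>L (M N) f) \<longlonglongrightarrow> integral\<^sup>L \<nu> f"
  proof (rule tendstoI)
    fix e :: real assume "e > 0"
    then obtain n where n: "\<And>y z. z \<in> cyl n y \<Longrightarrow> \<bar>f y - f z\<bar> < e / 3"
      using continuous_window[OF f, of "e / 3"] by auto
    define S where "S P = (\<Sum>t\<in>cyl_reps n. f t * measure P (cyl n t))" for P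
    have M: "\<bar>integral\<^sup>L (M N) f - S (M N)\<bar> \<le> e / 3" for N
      unfolding S_def using n \<open>e > 0\<close>
      by (intro cyl_average_approx[OF fin sets le1 f]) (auto intro: less_imp_le)
    interpret prob_space \<nu> using \<nu> by (simp add: borel_prob_def)
    have "sets \<nu> = sets borel" using \<nu> by (simp add: borel_prob_def)
    then have nu: "\<bar>integral\<^sup>L \<nu> f - S \<nu>\<bar> \<le> e / 3"
      unfolding S_def using n \<open>e > 0\<close>
      by (intro cyl_average_approx[OF _ _ _ f]) (auto intro: less_imp_le finite_measure_axioms)
    have "(\<lambda>N. S (M N)) \<longlonglongrightarrow> S \<nu>"
      unfolding S_def by (intro tendsto_sum tendsto_mult tendsto_const lim)
    then have "\<forall>\<^sub>F N in sequentially. dist (S (M N)) (S \<nu>) < e / 3"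
      using \<open>e > 0\<close> by (intro tendstoD) auto
    then show "\<forall>\<^sub>F N in sequentially. dist (integral\<^sup>L (M N) f) (integral\<^sup>L \<nu> f) < e"
    proof eventually_elim
      case (elim N)
      then show ?case using M[of N] nu unfolding dist_real_def by linarith
    qed
  qed
qed

lemma continuous_indicator_clopen:
  fixes C :: "'b::topological_space set"
  assumes "open C" "closed C"
  shows "continuous_on UNIV (indicat_real C)"
  using continuous_on_cases[of C "- C" "\<lambda>_. 1 :: real" "\<lambda>_. 0" "\<lambda>x. x \<in> C"] assms
  by (simp add: indicator_def of_bool_def closed_Compl)

text \<open>The indicator of a clopen set is continuous, hence an admissible test function.\<close>

lemma vague_limit_clopen:
  assumes "vague_limit M \<nu>" "\<And>N. sets (M N) = sets borel" "open C" "closed C"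
  shows "(\<lambda>N. measure (M N) C) \<longlonglongrightarrow> measure \<nu> C"
proof -
  have int: "integral\<^sup>L P (indicat_real C) = measure P C" if "sets P = sets borel" for P
    using sets_eq_imp_space_eq[OF that] by simp
  have lim: "(\<lambda>N. integral\<^sup>L (M N) (indicat_real C)) \<longlonglongrightarrow> integral\<^sup>L \<nu> (indicat_real C)"
    using assms(1) continuous_indicator_clopen[OF assms(3,4)] unfolding vague_limit_def by blast
  have "sets \<nu> = sets borel" using assms(1) by (simp add: vague_limit_def borel_prob_def)
  with lim show ?thesis by (simp only: int assms(2))
qed

section \<open>Recurrence and the limit measure\<close>

lemma vimage_borel:
  assumes "f \<in> borel_measurable (borel :: 'b::topological_space measure)" "E \<in> sets borel"
  shows "f -` E \<in> sets borel"
  using measurable_sets[OF assms] by simp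

lemma infinitely_often_shift:
  fixes P :: "int \<Rightarrow> bool"
  assumes "\<forall>n. \<exists>k\<ge>n. P (int k)"
  shows "\<forall>n. \<exists>k\<ge>n. P (int k + t)"
proof
  fix n
  \<comment> \<open>The surplus \<open>nat \<bar>t\<bar>\<close> makes \<open>int k - t\<close> at
    least \<open>int n\<close>, so the witness is a natural number.\<close>
  obtain k where "k \<ge> n + nat \<bar>t\<bar>" "P (int k)" using assms by blast
  then show "\<exists>k\<ge>n. P (int k + t)" by (intro exI[of _ "nat (int k - t)"]) auto
qed

text \<open>Its integral is the Cesaro mass of \<open>C\<close> (\<open>measure_cesaro\<close>), so
  limits of masses follow from pointwise limits of frequencies. At \<open>N = 0\<close> it is
  \<open>0\<close>, in accordance with the zero measure.\<close>

definition visit_freq :: "('b \<Rightarrow> 'b) \<Rightarrow> 'b set \<Rightarrow> nat \<Rightarrow> 'b \<Rightarrow> real" where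
  "visit_freq F C N y = (\<Sum>i<N. indicat_real C ((F ^^ i) y)) / real N"

lemma visit_freq_bounded: "\<bar>visit_freq F C N y\<bar> \<le> 1"
proof -
  have "(\<Sum>i<N. indicat_real C ((F ^^ i) y)) \<le> (\<Sum>i<N. 1)"
    by (intro sum_mono) (simp add: indicator_def)
  moreover have "0 \<le> (\<Sum>i<N. indicat_real C ((F ^^ i) y))"
    by (intro sum_nonneg) simp
  ultimately show ?thesis by (simp add: visit_freq_def divide_simps)
qed

section \<open>Recurrence under the shift\<close>

context
  fixes \<mu> :: "(int \<Rightarrow> 'a::{finite, discrete_topology}) measure"
  assumes prob: "borel_prob \<mu>" and erg: "shift_ergodic \<mu>"
begin

interpretation prob_space \<mu>
  using prob by (simp add: borel_prob_def)

lemma sets_mu: "sets \<mu> = sets borel"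
  using prob by (simp add: borel_prob_def)

lemma space_mu: "space \<mu> = UNIV"
  using sets_eq_imp_space_eq[OF sets_mu] by simp

lemma measure_translate:
  assumes "E \<in> sets borel"
  shows "measure \<mu> (translate k -` E) = measure \<mu> E"
proof -
  have 1: "measure \<mu> (translate 1 -` E) = measure \<mu> E" if "E \<in> sets borel" for E
  proof -
    have "translate 1 \<in> measurable \<mu> borel"
      using measurable_translate[of 1] measurable_cong_sets[OF sets_mu refl] by blast
    then have "measure (distr \<mu> borel (translate 1)) E = measure \<mu> (translate 1 -` E)"
      using that by (simp add: measure_distr space_mu)
    then show ?thesis using erg by (simp add: shift_ergodic_def shift_eq_translate)
  qed
  have 2: "measure \<mu> (translate (int n) -` E) = measure \<mu> E" if "E \<in> sets borel" for n E
  proof (induction n)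
    case (Suc n)
    have "translate (int (Suc n)) -` E = translate 1 -` (translate (int n) -` E)"
      by (auto simp: add.commute)
    then show ?case using 1 Suc vimage_borel[OF measurable_translate that] by metis
  qed simp
  show ?thesis
  proof (cases "k \<ge> 0")
    case True
    then show ?thesis using 2[OF assms, of "nat k"] by simp
  next
    case False
    \<comment> \<open>The positive power \<open>- k\<close> is applied to the preimage, which it
      turns back into \<open>E\<close>.\<close>
    have "translate (- k) -` (translate k -` E) = E" by auto
    then show ?thesis
      using 2[OF vimage_borel[OF measurable_translate assms], of "nat (- k)" k] False by simp
  qed
qed

text \<open>The set of points with infinitely many visits is shift invariant. Its measure is at
  least that of \<open>B\<close>, being the limit of the decreasing sets \<open>D n\<close>, each of
  which contains a translated copy of \<open>B\<close>; ergodicity raises it to \<open>1\<close>.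
  The sign \<open>s\<close> selects the direction.\<close>

lemma recurrence:
  assumes B: "B \<in> sets borel" "measure \<mu> B > 0" and s: "s \<in> {1, - 1}"
  shows "AE y in \<mu>. \<forall>n. \<exists>k\<ge>n. translate (s * int k) y \<in> B"
proof -
  define D where "D n = (\<Union>k\<in>{n..}. translate (s * int k) -` B)" for n :: nat
  have D_sets: "D n \<in> sets borel" for n
    unfolding D_def using vimage_borel[OF measurable_translate B(1)] by blast
  have "decseq D" by (rule decseq_SucI) (force simp: D_def)
  then have lim: "(\<lambda>n. measure \<mu> (D n)) \<longlonglongrightarrow> measure \<mu> (\<Inter>n. D n)"
    using D_sets by (intro finite_Lim_measure_decseq) (auto simp: sets_mu)
  have "measure \<mu> B \<le> measure \<mu> (D n)" for n
  proof -
    have "measure \<mu> (translate (s * int n) -` B) \<le> measure \<mu> (D n)"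
      using D_sets by (intro finite_measure_mono) (auto simp: D_def sets_mu)
    then show ?thesis by (simp add: measure_translate[OF B(1)])
  qed
  then have "measure \<mu> B \<le> measure \<mu> (\<Inter>n. D n)"
    by (intro LIMSEQ_le_const[OF lim]) auto
  moreover have "shift -` (\<Inter>n. D n) = (\<Inter>n. D n)"
  proof -
    have D_iff: "y \<in> (\<Inter>n. D n) \<longleftrightarrow> (\<forall>n. \<exists>k\<ge>n. translate (s * int k) y \<in> B)" for y
      by (simp add: D_def Bex_def)
    \<comment> \<open>As \<open>s * s = 1\<close>, one shift changes the visiting index by
      \<open>s\<close>, and a bounded change of index preserves infinitely many visits.\<close>
    have eq: "translate (s * int k) (shift y) = translate (s * (int k + s)) y" for k y
      using s by (auto simp: shift_eq_translate algebra_simps)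
    have "shift y \<in> (\<Inter>n. D n) \<longleftrightarrow> y \<in> (\<Inter>n. D n)" for y
      using infinitely_often_shift[of "\<lambda>k. translate (s * (k + s)) y \<in> B" "- s"]
        infinitely_often_shift[of "\<lambda>k. translate (s * k) y \<in> B" s]
      unfolding D_iff eq by auto
    then show ?thesis by (intro set_eqI) (simp only: vimage_eq)
  qed
  moreover have "(\<Inter>n. D n) \<in> sets borel" using D_sets by blast
  ultimately have "prob (\<Inter>n. D n) = 1"
    using erg B(2) unfolding shift_ergodic_def by fastforce
  then have "AE y in \<mu>. y \<in> (\<Inter>n. D n)" by (rule AE_prob_1)
  then show ?thesis by eventually_elim (auto simp: D_def)
qed

section \<open>Visit frequencies, existence of the limit measure, and its support\<close>

context
  fixes F :: "(int \<Rightarrow> 'a) \<Rightarrow> (int \<Rightarrow> 'a)"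
  assumes ca: "cellular_automaton F" and equi: "\<exists>x. mu_equicontinuous_point \<mu> F x"
begin

lemma measurable_funpow: "F ^^ i \<in> measurable \<mu> borel"
  using measurable_ca_funpow[OF ca] measurable_cong_sets[OF sets_mu refl] by blast

lemma orbit_cyl_borel: "orbit_cyl F m x \<in> sets borel"
proof -
  have "orbit_cyl F m x = (\<Inter>i. (F ^^ i) -` cyl m ((F ^^ i) x))"
    by (auto simp: orbit_cyl_def cyl_def)
  moreover have "\<dots> \<in> sets borel"
    using vimage_borel[OF measurable_ca_funpow[OF ca] measurable_cyl] by blast
  ultimately show ?thesis by simp
qed

text \<open>Recurrence in both directions encloses any window between two visits to the orbit
  cylinder of an equicontinuous point, and \<open>periodic_shadow\<close> applies to the block
  between them. One null set serves all \<open>n\<close>.\<close>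

lemma AE_shadow:
  "AE y in \<mu>. \<forall>n. \<exists>z p. p > 0 \<and> translate p z = z \<and>
     (\<forall>i j. \<bar>j\<bar> \<le> int n \<longrightarrow> (F ^^ i) z j = (F ^^ i) y j)"
proof -
  obtain x where x: "mu_equicontinuous_point \<mu> F x" using equi by blast
  obtain r where r: "\<And>x y j. (\<forall>i. \<bar>i - j\<bar> \<le> int r \<longrightarrow> x i = y i) \<Longrightarrow> F x j = F y j"
    using ca_local[OF ca] by blast
  let ?B = "orbit_cyl F r x"
  have "(\<lambda>n. measure \<mu> (cyl n x \<inter> ?B) / measure \<mu> (cyl n x)) \<longlonglongrightarrow> 1"
    using x by (simp add: mu_equicontinuous_point_def)
  \<comment> \<open>The quotient tends to \<open>1\<close>, so it is positive for some
    \<open>n\<close>, and then so is its numerator.\<close>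
  then have "\<forall>\<^sub>F n in sequentially. measure \<mu> (cyl n x \<inter> ?B) / measure \<mu> (cyl n x) > 0"
    by (rule order_tendstoD) simp
  then obtain n where "measure \<mu> (cyl n x \<inter> ?B) / measure \<mu> (cyl n x) > 0"
    by (auto simp: eventually_sequentially)
  then have "measure \<mu> (cyl n x \<inter> ?B) > 0"
    by (metis div_0 less_irrefl measure_nonneg order_less_le)
  also have "measure \<mu> (cyl n x \<inter> ?B) \<le> measure \<mu> ?B"
    by (intro finite_measure_mono) (auto simp: sets_mu orbit_cyl_borel)
  finally have pos: "measure \<mu> ?B > 0" .
  have rec: "AE y in \<mu>. \<forall>n. \<exists>k\<ge>n. translate (s * int k) y \<in> ?B" if "s \<in> {1, - 1}" for s
    by (rule recurrence[OF orbit_cyl_borel pos that])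
  from rec[of 1, simplified] rec[of "- 1", simplified] show ?thesis
  proof eventually_elim
    case (elim y)
    show ?case
    proof
      fix n
      \<comment> \<open>Both visits lie more than \<open>n + r\<close> away from the origin, so the
        block contains the window \<open>{- int n..int n}\<close> and its length exceeds
        \<open>r\<close>.\<close>
      obtain k l where k: "k \<ge> n + r + 1" "translate (int k) y \<in> ?B"
        and l: "l \<ge> n + r + 1" "translate (- int l) y \<in> ?B" using elim by meson
      have "\<exists>z. translate (int l + int k) z = z \<and> (\<forall>i j. - int l - int r \<le> j \<longrightarrow>
          j \<le> - int l + (int l + int k) + int r \<longrightarrow> (F ^^ i) z j = (F ^^ i) y j)"
        using k l by (intro periodic_shadow[OF ca r]) auto
      then obtain z where z: "translate (int l + int k) z = z"
        "\<And>i j. - int l - int r \<le> j \<Longrightarrow> j \<le> int k + int r \<Longrightarrow> (F ^^ i) z j = (F ^^ i) y j"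
        by auto
      show "\<exists>z p. p > 0 \<and> translate p z = z \<and>
          (\<forall>i j. \<bar>j\<bar> \<le> int n \<longrightarrow> (F ^^ i) z j = (F ^^ i) y j)"
        using k l z(1) by (intro exI[of _ z] exI[of _ "int l + int k"]) (auto intro!: z(2))
    qed
  qed
qed

text \<open>Membership in \<open>C\<close> depends on a finite window. On it the shadow
  \<open>z\<close> agrees with \<open>y\<close> at all times, so both visit \<open>C\<close> at the
  same times, and the orbit of \<open>z\<close> is eventually periodic.\<close>

lemma AE_convergent_visit_freq:
  assumes "open C" "closed C"
  shows "AE y in \<mu>. convergent (\<lambda>N. visit_freq F C N y)"
  using AE_shadow
proof eventually_elim
  case (elim y)
  from clopen_window[OF assms] obtain n where n: "\<And>y z. z \<in> cyl n y \<Longrightarrow> z \<in> C \<longleftrightarrow> y \<in> C"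
    by blast
  from elim obtain z p where z: "p > 0" "translate p z = z"
    "\<And>i j. \<bar>j\<bar> \<le> int n \<Longrightarrow> (F ^^ i) z j = (F ^^ i) y j" by blast
  obtain q d where qd: "d > 0" "\<And>i. i \<ge> q \<Longrightarrow> (F ^^ (i + d)) z = (F ^^ i) z"
    using spatially_periodic_eventually_periodic[OF ca z(1,2)] by blast
  have "(F ^^ i) z \<in> cyl n ((F ^^ i) y)" for i
    using z(3) by (auto simp: cyl_def abs_le_iff)
  from n[OF this] have "indicat_real C ((F ^^ i) y) = indicat_real C ((F ^^ i) z)" for i
    by (simp add: indicator_def)
  then show ?case
    unfolding visit_freq_def using qd
    by (intro eventually_periodic_cesaro_convergent[of d q]) simp_all
qed

lemma measure_cesaro:
  assumes "C \<in> sets borel"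
  shows "measure (cesaro_measure \<mu> F N) C = integral\<^sup>L \<mu> (visit_freq F C N)"
proof -
  have pre: "(F ^^ i) -` C \<in> sets \<mu>" for i
    using measurable_sets[OF measurable_funpow assms] by (simp add: space_mu)
  have "emeasure (cesaro_measure \<mu> F N) C = (\<Sum>i<N. ennreal (measure \<mu> ((F ^^ i) -` C))) / of_nat N"
    using assms by (simp add: emeasure_cesaro_measure emeasure_distr measurable_funpow space_mu emeasure_eq_measure)
  also have "\<dots> = ennreal ((\<Sum>i<N. measure \<mu> ((F ^^ i) -` C)) / real N)"
    \<comment> \<open>At \<open>N = 0\<close> both sides are \<open>0\<close> by the conventions on
      division by zero.\<close>
    by (cases "N = 0") (simp_all add: sum_ennreal divide_ennreal sum_nonneg ennreal_of_nat_eq_real_of_nat)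
  finally have "measure (cesaro_measure \<mu> F N) C = (\<Sum>i<N. measure \<mu> ((F ^^ i) -` C)) / real N"
    by (simp add: measure_def sum_nonneg)
  also have "\<dots> = integral\<^sup>L \<mu> (\<lambda>y. (\<Sum>i<N. indicat_real ((F ^^ i) -` C) y) / real N)"
    using pre by (simp add: space_mu integrable_real_indicator emeasure_eq_measure)
  finally show ?thesis by (simp add: visit_freq_def[abs_def] indicator_def)
qed

lemma measurable_visit_freq:
  assumes "C \<in> sets borel"
  shows "visit_freq F C N \<in> borel_measurable \<mu>"
proof -
  have "(\<lambda>y. indicat_real C ((F ^^ i) y)) \<in> borel_measurable \<mu>" for i
    using measurable_compose[OF measurable_funpow borel_measurable_indicator[OF assms]] .
  then show ?thesis unfolding visit_freq_def[abs_def] by measurable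
qed

text \<open>Dominated convergence with the constant bound \<open>1\<close>; the points at which
  \<open>lim\<close> is a mere default value form a null set.\<close>

lemma cesaro_clopen_limit:
  assumes "open C" "closed C"
  shows "(\<lambda>N. measure (cesaro_measure \<mu> F N) C)
    \<longlonglongrightarrow> integral\<^sup>L \<mu> (\<lambda>y. lim (\<lambda>N. visit_freq F C N y))"
proof -
  have C: "C \<in> sets borel" using assms(1) by simp
  note [measurable] = measurable_visit_freq[OF C]
  have "(\<lambda>N. integral\<^sup>L \<mu> (visit_freq F C N)) \<longlonglongrightarrow> integral\<^sup>L \<mu> (\<lambda>y. lim (\<lambda>N. visit_freq F C N y))"
  proof (rule integral_dominated_convergence[where w = "\<lambda>_. 1"])
    show "AE y in \<mu>. (\<lambda>N. visit_freq F C N y) \<longlonglongrightarrow> lim (\<lambda>N. visit_freq F C N y)"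
      using AE_convergent_visit_freq[OF assms] by eventually_elim (simp add: convergent_LIMSEQ_iff)
  qed (simp_all add: visit_freq_bounded)
  then show ?thesis by (simp add: measure_cesaro[OF C])
qed

text \<open>The limits of masses on clopen sets are finitely additive and extend to a measure; as
  cylinders are clopen, \<open>vague_limitI_cyl\<close> identifies it as the vague limit.\<close>

lemma vague_limit_exists: "\<exists>\<nu>. vague_limit (cesaro_measure \<mu> F) \<nu>"
proof -
  \<comment> \<open>The default \<open>0\<close> off the clopen sets makes \<open>?L\<close>
    nonnegative on every set.\<close>
  let ?L = "\<lambda>C. if open C \<and> closed C then lim (\<lambda>N. measure (cesaro_measure \<mu> F N) C) else 0"
  have L: "(\<lambda>N. measure (cesaro_measure \<mu> F N) C) \<longlonglongrightarrow> ?L C" if "open C" "closed C" for C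
    using cesaro_clopen_limit[OF that] that by (auto simp: limI)
  have UN: "measure (cesaro_measure \<mu> F N) UNIV = (if N = 0 then 0 else 1)" for N
    by (simp add: measure_cesaro visit_freq_def[abs_def] prob_space)
  have fin: "finite_measure (cesaro_measure \<mu> F N)" for N
  proof
    have "emeasure (cesaro_measure \<mu> F N) UNIV \<le> (\<Sum>i<N. 1) / of_nat N"
      by (simp add: emeasure_cesaro_measure emeasure_distr measurable_funpow
          emeasure_space_1[unfolded space_mu] space_mu)
    also have "\<dots> < \<infinity>" by (cases "N = 0") (simp_all add: ennreal_of_nat_eq_real_of_nat divide_ennreal)
    finally show "emeasure (cesaro_measure \<mu> F N) (space (cesaro_measure \<mu> F N)) \<noteq> \<infinity>"
      using sets_eq_imp_space_eq[OF sets_cesaro_measure[of \<mu> F N]] by (simp add: less_top)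
  qed
  have "\<exists>\<nu>. borel_prob \<nu> \<and> (\<forall>C. open C \<longrightarrow> closed C \<longrightarrow> measure \<nu> C = ?L C)"
  proof (rule clopen_content_extension)
    show "0 \<le> ?L C" for C
      using LIMSEQ_le_const[OF L[of C]] by auto
  next
    fix C D :: "(int \<Rightarrow> 'a) set"
    assume *: "open C" "closed C" "open D" "closed D" "C \<inter> D = {}"
    have "measure (cesaro_measure \<mu> F N) (C \<union> D)
        = measure (cesaro_measure \<mu> F N) C + measure (cesaro_measure \<mu> F N) D" for N
      using * by (intro finite_measure.finite_measure_Union[OF fin]) auto
    then have "(\<lambda>N. measure (cesaro_measure \<mu> F N) (C \<union> D)) \<longlonglongrightarrow> ?L C + ?L D"
      using tendsto_add[OF L L, of C D] * by simp
    then show "?L (C \<union> D) = ?L C + ?L D"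
      using L[of "C \<union> D"] * by (intro LIMSEQ_unique) auto
  next
    have "(\<lambda>N. measure (cesaro_measure \<mu> F N) UNIV) \<longlonglongrightarrow> 1"
      unfolding UN by (rule tendsto_eventually) (use eventually_gt_at_top[of 0] in eventually_elim, simp)
    then show "?L UNIV = 1" by (simp add: limI)
  qed
  then obtain \<nu> where \<nu>: "borel_prob \<nu>" "\<And>C. open C \<Longrightarrow> closed C \<Longrightarrow> measure \<nu> C = ?L C"
    by blast
  have "vague_limit (cesaro_measure \<mu> F) \<nu>"
  proof (rule vague_limitI_cyl[OF fin _ _ \<nu>(1)])
    show "(\<lambda>N. measure (cesaro_measure \<mu> F N) (cyl n t)) \<longlonglongrightarrow> measure \<nu> (cyl n t)" for n t
      using L[OF open_cyl closed_cyl] unfolding \<nu>(2)[OF open_cyl closed_cyl] .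
  qed (simp_all add: UN)
  then show ?thesis ..
qed

text \<open>The mass of the cylinder is the integral of the limit frequency, so some shadowed
  \<open>y\<close> has nonzero frequency. It returns after the preperiod of its shadow
  \<open>z\<close>, and at such a time the orbit of \<open>z\<close> is in the cylinder and on its
  cycle.\<close>

lemma periodic_point_in_charged_cyl:
  assumes "vague_limit (cesaro_measure \<mu> F) \<nu>" "measure \<nu> (cyl n x) > 0"
  shows "\<exists>z\<in>periodic_points F. z \<in> cyl n x"
proof -
  let ?C = "cyl n x"
  have "integral\<^sup>L \<mu> (\<lambda>y. lim (\<lambda>N. visit_freq F ?C N y)) = measure \<nu> ?C"
    by (rule LIMSEQ_unique[OF cesaro_clopen_limit[OF open_cyl closed_cyl]
          vague_limit_clopen[OF assms(1) sets_cesaro_measure open_cyl closed_cyl]])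
  then have nonzero: "\<not> (AE y in \<mu>. lim (\<lambda>N. visit_freq F ?C N y) = 0)"
    using assms(2) integral_eq_zero_AE[where f = "\<lambda>y. lim (\<lambda>N. visit_freq F ?C N y)"] by auto
  \<comment> \<open>The shadowing property holds almost everywhere, the vanishing of the limit
    frequency does not; hence some point has a shadow and nonzero frequency.\<close>
  have "\<exists>y. lim (\<lambda>N. visit_freq F ?C N y) \<noteq> 0 \<and> (\<exists>z p. p > 0 \<and> translate p z = z \<and>
      (\<forall>i j. \<bar>j\<bar> \<le> int n \<longrightarrow> (F ^^ i) z j = (F ^^ i) y j))"
  proof (rule ccontr)
    assume *: "\<not> ?thesis"
    from AE_shadow have "AE y in \<mu>. lim (\<lambda>N. visit_freq F ?C N y) = 0"
    proof eventually_elim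
      case (elim y)
      with * show ?case by blast
    qed
    with nonzero show False ..
  qed
  then obtain y z p where lim0: "lim (\<lambda>N. visit_freq F ?C N y) \<noteq> 0"
    and z: "p > 0" "translate p z = z" "\<And>i j. \<bar>j\<bar> \<le> int n \<Longrightarrow> (F ^^ i) z j = (F ^^ i) y j"
    by meson
  obtain q d where qd: "d > 0" "\<And>i. i \<ge> q \<Longrightarrow> (F ^^ (i + d)) z = (F ^^ i) z"
    using spatially_periodic_eventually_periodic[OF ca z(1,2)] by blast
  \<comment> \<open>With no visit from time \<open>q\<close> on, at most \<open>q\<close> visits
    occur in all, which forces the limit frequency \<open>0\<close>.\<close>
  have "\<exists>i\<ge>q. (F ^^ i) y \<in> ?C"
  proof (rule ccontr)
    assume never: "\<not> ?thesis"
    have "\<bar>\<Sum>i<N. indicat_real ?C ((F ^^ i) y)\<bar> \<le> real q" for N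
    proof -
      have "(\<Sum>i<N. indicat_real ?C ((F ^^ i) y)) \<le> (\<Sum>i<N. indicat_real {..<q} i)"
        using never by (intro sum_mono) (auto simp: indicator_def not_le[symmetric])
      also have "\<dots> = real (card ({..<N} \<inter> {..<q}))"
        by (simp add: indicator_def of_bool_def sum.If_cases lessThan_def)
      also have "\<dots> \<le> real (card {..<q})" by (intro of_nat_mono card_mono) auto
      finally show ?thesis by (simp add: sum_nonneg)
    qed
    then have "(\<lambda>N. visit_freq F ?C N y) \<longlonglongrightarrow> 0"
      unfolding visit_freq_def by (rule bounded_over_n_tendsto_0)
    with lim0 show False by (simp add: limI)
  qed
  then obtain i where i: "i \<ge> q" "(F ^^ i) y \<in> ?C" by blast
  have "(F ^^ i) z \<in> ?C" using i(2) z(3)[of _ i] by (auto simp: cyl_def abs_le_iff)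
  moreover have "(F ^^ d) ((F ^^ i) z) = (F ^^ i) z"
    using qd(2)[OF i(1)] by (simp add: add.commute funpow_add)
  then have "(F ^^ i) z \<in> periodic_points F"
    using qd(1) unfolding periodic_points_def by (intro CollectI exI[of _ d]) auto
  ultimately show ?thesis by blast
qed

text \<open>Each neighbourhood of a point whose cylinders are all charged contains such a cylinder,
  hence a periodic point. The closure in the support is absorbed because the right-hand side is
  closed.\<close>

lemma support_subset_closure_periodic:
  assumes "vague_limit (cesaro_measure \<mu> F) \<nu>"
  shows "topological_support \<nu> \<subseteq> closure (periodic_points F)"
  unfolding topological_support_def
proof (rule closure_minimal[OF _ closed_closure], rule subsetI)
  fix x assume x: "x \<in> {x. \<forall>n. measure \<nu> (cyl n x) > 0}"
  show "x \<in> closure (periodic_points F)"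
    unfolding closure_iff_nhds_not_empty
  proof (intro allI impI)
    fix A U :: "(int \<Rightarrow> 'a) set" assume "U \<subseteq> A" "open U" "x \<in> U"
    then obtain n where "cyl n x \<subseteq> U" unfolding open_iff_cyl by blast
    then show "periodic_points F \<inter> A \<noteq> {}"
      using periodic_point_in_charged_cyl[OF assms, of n x] x \<open>U \<subseteq> A\<close> by blast
  qed
qed

end

end

theorem corollary2p1:
  fixes \<mu> :: "(int \<Rightarrow> 'a::{finite, discrete_topology}) measure"
    and F :: "(int \<Rightarrow> 'a) \<Rightarrow> (int \<Rightarrow> 'a)"
  assumes "borel_prob \<mu>"
    and "shift_ergodic \<mu>"
    and "cellular_automaton F"
    and "\<exists>x. mu_equicontinuous_point \<mu> F x"
  shows "(\<exists>\<mu>\<^sub>c. vague_limit (cesaro_measure \<mu> F) \<mu>\<^sub>c) \<and>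
    (\<forall>\<mu>\<^sub>c. vague_limit (cesaro_measure \<mu> F) \<mu>\<^sub>c \<longrightarrow>
       topological_support \<mu>\<^sub>c \<subseteq> closure (periodic_points F))"
  using vague_limit_exists[OF assms] support_subset_closure_periodic[OF assms] by blast

end
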